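(* Let $S = \langle g_1, \ldots, g_k\rangle$ be a numerical semigroup. If $p \in \mathbb{Z}_{\ge 2}$, then $\ell_p^M(n)$ is, as a function of $n$, eventually quasipolynomial with degree $p$, period $g_1$, and constant leading coefficient $1/g_1^p$.
   Context: A numerical semigroup $S$ is an additive submonoid of $\mathbb{Z}_{\ge 0}$ with finite complement. Writing $S = \langle g_1, \ldots, g_k\rangle = \{z_1 g_1 + \cdots + z_k g_k : z_1, \ldots, z_k \in \mathbb{Z}_{\ge 0}\}$ means that $g_1 < g_2 < \cdots < g_k$ are the atoms (irreducible elements, i.e. minimal generators) of $S$. For $n \in S$, the set of factorizations of $n$ is $\mathsf{Z}(n) = \{\mathbf{z} \in \mathbb{Z}_{\ge 0}^k : n = z_1 g_1 + \cdots + z_k g_k\}$. For $\mathbf{z} \in \mathbb{Z}^k$ and an integer $p \ge 1$, let $\ell_p(\mathbf{z}) = z_1^p + \cdots + z_k^p$, and for $n \in S$ let $\ell_p^M(n) = \max\{\ell_p(\mathbf{z}) : \mathbf{z} \in \mathsf{Z}(n)\}$. A function $f : \mathbb{Z}_{\ge 0} \to \mathbb{R}$ is a quasipolynomial if there exist periodic functions $c_d(n), \ldots, c_0(n)$, with $c_d$ not identically $0$, such that $f(n) = c_d(n) n^d + \cdots + c_1(n) n + c_0(n)$; the degree of $f$ is $d$, its leading coefficient is $c_d$, and its period is the least common multiple of the periods of the $c_i(n)$. A function $f$ is eventually quasipolynomial if there is a quasipolynomial $h$ with $f(n) = h(n)$ for all but finitely many $n \in \mathbb{Z}_{\ge 0}$;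 the degree, period and leading coefficient of $f$ are those of $h$. (Note $\ell_p^M(n)$ is defined for all $n \in S$, hence for all but finitely many $n \in \mathbb{Z}_{\ge 0}$.) *)

theory Defs
  imports Complex_Main "HOL-Computational_Algebra.Polynomial"
begin

section \<open>Numerical semigroups and factorizations\<close>

definition numerical_semigroup :: "nat set \<Rightarrow> bool" where
  "numerical_semigroup S \<longleftrightarrow> 0 \<in> S \<and> (\<forall>a\<in>S. \<forall>b\<in>S. a + b \<in> S) \<and> finite (UNIV - S)"

definition atoms :: "nat set \<Rightarrow> nat set" where
  "atoms S = {a \<in> S. a \<noteq> 0 \<and> (\<forall>b\<in>S. \<forall>c\<in>S. a = b + c \<longrightarrow> b = 0 \<or> c = 0)}"

text \<open>
  The generators \<open>g\<^sub>1, \<dots>, g\<^sub>k\<close> form a list \<open>gs\<close>, indexed from 0, and elements of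
  \<open>\<int>\<^sub>\<ge>\<^sub>0\<^sup>k\<close> are lists of the same length as \<open>gs\<close>.
\<close>

definition factorizations :: "nat list \<Rightarrow> nat \<Rightarrow> nat list set" where
  "factorizations gs n = {z. length z = length gs \<and> n = (\<Sum>i<length gs. z ! i * gs ! i)}"

definition generated :: "nat list \<Rightarrow> nat set" where
  "generated gs = {\<Sum>i<length gs. z ! i * gs ! i | z. length z = length gs}"

definition minimally_generated_by :: "nat set \<Rightarrow> nat list \<Rightarrow> bool" where
  "minimally_generated_by S gs \<longleftrightarrow>
     S = generated gs \<and> sorted_wrt (<) gs \<and> set gs = atoms S"

definition ell :: "nat \<Rightarrow> 'a::comm_semiring_1 list \<Rightarrow> 'a" where
  "ell p z = (\<Sum>i<length z. z ! i ^ p)"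

text \<open>
  Only meaningful if \<open>n \<in> generated gs\<close>; otherwise this is the maximum of the empty set,
  an unspecified number.
\<close>

definition ell_max :: "nat list \<Rightarrow> nat \<Rightarrow> nat \<Rightarrow> nat" where
  "ell_max gs p n = Max (ell p ` factorizations gs n)"

section \<open>Quasipolynomials\<close>

definition is_period :: "(nat \<Rightarrow> 'a) \<Rightarrow> nat \<Rightarrow> bool" where
  "is_period c t \<longleftrightarrow> t > 0 \<and> (\<forall>n. c (n + t) = c n)"

definition periodic :: "(nat \<Rightarrow> 'a) \<Rightarrow> bool" where
  "periodic c \<longleftrightarrow> (\<exists>t. is_period c t)"

definition min_period :: "(nat \<Rightarrow> 'a) \<Rightarrow> nat" where
  "min_period c = (LEAST t. is_period c t)"

definition quasipolynomial_coeffs :: "(nat \<Rightarrow> real) \<Rightarrow> nat \<Rightarrow> (nat \<Rightarrow> nat \<Rightarrow> real) \<Rightarrow> bool" where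
  "quasipolynomial_coeffs h d c \<longleftrightarrow>
     (\<forall>i\<le>d. periodic (c i)) \<and> (\<exists>n. c d n \<noteq> 0) \<and>
     (\<forall>n. h n = (\<Sum>i\<le>d. c i n * real n ^ i))"

text \<open>
  \<open>quasipolynomial h d t a\<close>: \<open>h\<close> is a quasipolynomial of degree \<open>d\<close>, period \<open>t\<close> and leading
  coefficient \<open>a\<close>.  The period is exact: it is the least common multiple of the least
  periods of the coefficients.
\<close>

definition quasipolynomial ::
    "(nat \<Rightarrow> real) \<Rightarrow> nat \<Rightarrow> nat \<Rightarrow> (nat \<Rightarrow> real) \<Rightarrow> bool" where
  "quasipolynomial h d t a \<longleftrightarrow>
     (\<exists>c. quasipolynomial_coeffs h d c \<and> t = Lcm ((\<lambda>i. min_period (c i)) ` {..d}) \<and> a = c d)"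

definition eventually_quasipolynomial ::
    "(nat \<Rightarrow> real) \<Rightarrow> nat \<Rightarrow> nat \<Rightarrow> (nat \<Rightarrow> real) \<Rightarrow> bool" where
  "eventually_quasipolynomial f d t a \<longleftrightarrow>
     (\<exists>h. finite {n. f n \<noteq> h n} \<and> quasipolynomial h d t a)"

text \<open>
  Degree, period and leading coefficient are determined by the function, so the relational
  form of the last two definitions is harmless.
\<close>

lemma is_period_mult:
  assumes "is_period c t"
  shows "c (n + t * m) = c n"
proof (induction m)
  case (Suc m)
  have "c (n + t * Suc m) = c ((n + t * m) + t)" by (simp add: algebra_simps)
  also have "\<dots> = c (n + t * m)" using assms by (simp only: is_period_def)
  finally show ?case using Suc by simp
qed simp

lemma common_period:
  fixes c :: "nat \<Rightarrow> nat \<Rightarrow> 'a"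
  assumes "\<forall>i\<le>d. periodic (c i)"
  obtains t where "t > 0" "\<And>i n m. i \<le> d \<Longrightarrow> c i (n + t * m) = c i n"
proof -
  obtain T where T: "\<And>i. i \<le> d \<Longrightarrow> is_period (c i) (T i)"
    using assms unfolding periodic_def by metis
  let ?t = "\<Prod>i\<le>d. T i"
  have "?t > 0" using T by (intro prod_pos) (auto simp: is_period_def)
  moreover have "c i (n + ?t * m) = c i n" if i: "i \<le> d" for i n m
  proof -
    have "T i dvd ?t" using i by (intro dvd_prodI) auto
    then obtain q where "?t = T i * q" by (elim dvdE)
    then show ?thesis using is_period_mult[OF T[OF i], of n "q * m"] by (simp add: mult.assoc)
  qed
  ultimately show ?thesis by (rule that)
qed

lemma quasipolynomial_coeffs_unique:
  assumes h: "quasipolynomial_coeffs h d c" and h': "quasipolynomial_coeffs h' d' c'"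
    and fin: "finite {n. h n \<noteq> h' n}"
  shows "d = d'" and "\<And>i. i \<le> d \<Longrightarrow> c i = c' i"
proof -
  have per: "\<forall>i\<le>d. periodic (c i)" and per': "\<forall>i\<le>d'. periodic (c' i)"
    using h h' by (simp_all add: quasipolynomial_coeffs_def)
  obtain t where t: "t > 0" "\<And>i n m. i \<le> d \<Longrightarrow> c i (n + t * m) = c i n"
    using common_period[OF per] by metis
  obtain t' where t': "t' > 0" "\<And>i n m. i \<le> d' \<Longrightarrow> c' i (n + t' * m) = c' i n"
    using common_period[OF per'] by metis
  define P where "P r = (\<Sum>i\<le>d. monom (c i r) i)" for r
  define Q where "Q r = (\<Sum>i\<le>d'. monom (c' i r) i)" for r
  have PQ: "P r = Q r" for r
  proof (rule ccontr)
    assume ne: "P r \<noteq> Q r"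
    define g where "g m = r + t * t' * m" for m
    have inj: "inj g" using t(1) t'(1) by (auto simp: inj_def g_def)
    have P: "h (g m) = poly (P r) (real (g m))" for m
    proof -
      have "h (g m) = (\<Sum>i\<le>d. c i (g m) * real (g m) ^ i)"
        using h by (simp add: quasipolynomial_coeffs_def)
      also have "\<dots> = (\<Sum>i\<le>d. c i r * real (g m) ^ i)"
        using t(2)[of _ r "t' * m"] by (intro sum.cong) (auto simp: g_def mult.assoc)
      finally show ?thesis by (simp add: P_def poly_sum poly_monom)
    qed
    have Q: "h' (g m) = poly (Q r) (real (g m))" for m
    proof -
      have "h' (g m) = (\<Sum>i\<le>d'. c' i (g m) * real (g m) ^ i)"
        using h' by (simp add: quasipolynomial_coeffs_def)
      also have "\<dots> = (\<Sum>i\<le>d'. c' i r * real (g m) ^ i)"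
        using t'(2)[of _ r "t * m"] by (intro sum.cong) (auto simp: g_def ac_simps)
      finally show ?thesis by (simp add: Q_def poly_sum poly_monom)
    qed
    have "finite {x. poly (P r - Q r) x = 0}" using ne by (intro poly_roots_finite) simp
    then have "finite ((\<lambda>m. real (g m)) -` {x. poly (P r - Q r) x = 0})"
      by (rule finite_vimageI) (use inj in \<open>auto simp: inj_def\<close>)
    moreover have "finite (g -` {n. h n \<noteq> h' n})" by (rule finite_vimageI[OF fin inj])
    ultimately have "finite ((\<lambda>m. real (g m)) -` {x. poly (P r - Q r) x = 0}
                             \<union> g -` {n. h n \<noteq> h' n})" by blast
    moreover have "(\<lambda>m. real (g m)) -` {x. poly (P r - Q r) x = 0}
                   \<union> g -` {n. h n \<noteq> h' n} = UNIV"
      by (auto simp: P Q)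
    ultimately show False using infinite_UNIV_nat by metis
  qed
  have cP: "coeff (P r) i = (if i \<le> d then c i r else 0)" for r i
    by (simp add: P_def coeff_sum)
  have cQ: "coeff (Q r) i = (if i \<le> d' then c' i r else 0)" for r i
    by (simp add: Q_def coeff_sum)
  have eq: "(if i \<le> d then c i r else 0) = (if i \<le> d' then c' i r else 0)" for r i
    using cP[of r i] cQ[of r i] PQ[of r] by simp
  obtain n n' where n: "c d n \<noteq> 0" "c' d' n' \<noteq> 0"
    using h h' by (auto simp: quasipolynomial_coeffs_def)
  show "d = d'"
    using eq[of d n] eq[of d' n'] n by (auto split: if_splits)
  then show "c i = c' i" if "i \<le> d" for i
    using that eq[of i] by (auto simp: fun_eq_iff)
qed

lemma eventually_quasipolynomial_unique:
  assumes "eventually_quasipolynomial f d t a" and "eventually_quasipolynomial f d' t' a'"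
  shows "d = d' \<and> t = t' \<and> a = a'"
proof -
  obtain h c where h: "finite {n. f n \<noteq> h n}" "quasipolynomial_coeffs h d c"
      "t = Lcm ((\<lambda>i. min_period (c i)) ` {..d})" "a = c d"
    using assms(1) by (auto simp: eventually_quasipolynomial_def quasipolynomial_def)
  obtain h' c' where h': "finite {n. f n \<noteq> h' n}" "quasipolynomial_coeffs h' d' c'"
      "t' = Lcm ((\<lambda>i. min_period (c' i)) ` {..d'})" "a' = c' d'"
    using assms(2) by (auto simp: eventually_quasipolynomial_def quasipolynomial_def)
  have "finite {n. h n \<noteq> h' n}"
    by (rule finite_subset[of _ "{n. f n \<noteq> h n} \<union> {n. f n \<noteq> h' n}"]) (use h h' in auto)
  note u = quasipolynomial_coeffs_unique[OF h(2) h'(2) this]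
  have "(\<lambda>i. min_period (c i)) ` {..d} = (\<lambda>i. min_period (c' i)) ` {..d}"
    by (intro image_cong) (use u(2) in auto)
  then show ?thesis using u h h' by auto
qed

end

theory Submission
  imports Defs
begin

text \<open>
  Write \<open>g\<close> for the least generator, \<open>a\<close> for the least element of \<open>S\<close> congruent to \<open>n\<close> modulo
  \<open>g\<close>, and \<open>n = g N + a\<close>.  For large \<open>n\<close> the maximum is \<open>N\<^sup>p\<close> plus the maximum for \<open>a\<close>:
  a factorization that uses \<open>g\<close> fewer than \<open>N\<close> times and has \<open>y\<close> further atoms
  satisfies \<open>g x + (g + 1) y \<le> g N + a\<close> with \<open>x < N\<close>.  If \<open>y \<ge> a\<close>, then \<open>x + y \<le> N\<close> and its value
  is at most \<open>(x + y)\<^sup>p \<le> N\<^sup>p\<close>; if \<open>y < a\<close>, its value is at most \<open>(N - 1)\<^sup>p + a\<^sup>p \<le> N\<^sup>p\<close>.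
  Expanding \<open>((n - a) / g)\<^sup>p\<close> gives the coefficients.  The one of degree \<open>p - 1\<close> is a nonzero
  multiple of \<open>a\<close>, which determines \<open>n\<close> modulo \<open>g\<close>, so that the period is no smaller than \<open>g\<close>.
\<close>

section \<open>Least periods\<close>

lemma min_period_dvd:
  assumes "is_period c t"
  shows "min_period c dvd t"
proof -
  define m where "m = min_period c"
  have m: "is_period c m"
    unfolding m_def min_period_def using assms by (rule LeastI)
  have "c (n + t mod m) = c n" for n
  proof -
    have "c (n + t mod m) = c (n + t mod m + m * (t div m))"
      by (rule is_period_mult[OF m, symmetric])
    also have "n + t mod m + m * (t div m) = n + t" by simp
    finally show ?thesis using assms by (simp add: is_period_def)
  qed
  moreover have "t mod m < m" using m by (simp add: is_period_def)
  then have "\<not> is_period c (t mod m)"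
    unfolding m_def min_period_def by (rule not_less_Least)
  ultimately have "t mod m = 0" by (auto simp: is_period_def)
  then show ?thesis by (auto simp: m_def)
qed

lemma is_period_min_period:
  assumes "periodic c"
  shows "is_period c (min_period c)"
  using assms unfolding periodic_def min_period_def by (metis LeastI)

section \<open>Factorizations and their power sums\<close>

lemma ell_Nil [simp]: "ell p [] = 0"
  by (simp add: ell_def)

lemma ell_Cons [simp]: "ell p (x # xs) = x ^ p + ell p xs"
  by (simp add: ell_def sum.lessThan_Suc_shift del: sum.lessThan_Suc)

lemma factorizations_Nil: "z \<in> factorizations [] n \<longleftrightarrow> z = [] \<and> n = 0"
  by (auto simp: factorizations_def)

lemma factorizations_Cons:
  "z \<in> factorizations (g # gs) n \<longleftrightarrow>
     (\<exists>x ys w. z = x # ys \<and> ys \<in> factorizations gs w \<and> n = x * g + w)"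
  by (cases z)
     (auto simp: factorizations_def sum.lessThan_Suc_shift simp del: sum.lessThan_Suc)

lemma generated_iff: "n \<in> generated gs \<longleftrightarrow> factorizations gs n \<noteq> {}"
  by (auto simp: generated_def factorizations_def)

text \<open>Positive generators bound every entry by \<open>n\<close>. Together with nonemptiness
  this makes \<open>ell_max\<close> a maximum that is attained.\<close>

lemma finite_factorizations:
  assumes "0 \<notin> set gs"
  shows "finite (factorizations gs n)"
proof (rule finite_subset)
  show "factorizations gs n \<subseteq> {z. set z \<subseteq> {..n} \<and> length z = length gs}"
  proof
    fix z assume "z \<in> factorizations gs n"
    then have len: "length z = length gs" and n: "n = (\<Sum>i<length gs. z ! i * gs ! i)"
      by (auto simp: factorizations_def)
    have "z ! i \<le> n" if "i < length gs" for i
    proof -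
      have "gs ! i > 0" using assms that by (metis gr0I nth_mem)
      then have "z ! i \<le> z ! i * gs ! i" by simp
      also have "\<dots> \<le> n" unfolding n using that by (intro member_le_sum) auto
      finally show ?thesis .
    qed
    then show "z \<in> {z. set z \<subseteq> {..n} \<and> length z = length gs}"
      using len by (auto simp: in_set_conv_nth)
  qed
qed (simp add: finite_lists_length_eq)

lemma ell_le_ell_max:
  assumes "0 \<notin> set gs" "z \<in> factorizations gs n"
  shows "ell p z \<le> ell_max gs p n"
  unfolding ell_max_def using assms finite_factorizations by (intro Max_ge) auto

lemma ell_max_attained:
  assumes "0 \<notin> set gs" "n \<in> generated gs"
  obtains z where "z \<in> factorizations gs n" "ell_max gs p n = ell p z"
proof -
  have "ell_max gs p n \<in> ell p ` factorizations gs n"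
    unfolding ell_max_def using assms finite_factorizations generated_iff by (intro Max_in) auto
  then show ?thesis using that by blast
qed

lemma power_add_le_add_power:
  fixes x y :: "'a::linordered_semidom"
  assumes "x \<ge> 0" "y \<ge> 0" "p > 0"
  shows "x ^ p + y ^ p \<le> (x + y) ^ p"
proof -
  obtain q where p: "p = Suc q" using assms(3) by (cases p) auto
  have "x ^ p + y ^ p \<le> x * (x + y) ^ q + y * (x + y) ^ q"
    unfolding p power_Suc using assms by (intro add_mono mult_left_mono power_mono) auto
  then show ?thesis by (simp add: p distrib_right)
qed

lemma ell_le_power_ell_1:
  fixes zs :: "nat list"
  assumes "p > 0"
  shows "ell p zs \<le> ell 1 zs ^ p"
proof (induction zs)
  case (Cons z zs)
  have "ell p (z # zs) \<le> z ^ p + ell 1 zs ^ p" using Cons by simp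
  also have "\<dots> \<le> (z + ell 1 zs) ^ p" using assms by (intro power_add_le_add_power) auto
  finally show ?case by simp
qed simp

text \<open>Here \<open>ell 1 z\<close> is the number of atoms used, counted with multiplicity, and
  each of them contributes at least \<open>b\<close>.\<close>

lemma ell_1_le_factorizations:
  assumes "\<forall>g\<in>set gs. b \<le> g" "z \<in> factorizations gs n"
  shows "b * ell 1 z \<le> n"
  using assms
proof (induction gs arbitrary: z n)
  case Nil
  then show ?case by (simp add: factorizations_Nil)
next
  case (Cons g gs)
  then obtain x ys w where z: "z = x # ys" "ys \<in> factorizations gs w" "n = x * g + w"
    by (auto simp: factorizations_Cons)
  have "b * ell 1 ys \<le> w" using Cons z by auto
  moreover have "x * b \<le> x * g" using Cons.prems(1) by (intro mult_left_mono) auto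
  ultimately show ?case
    unfolding z ell_Cons power_one_right distrib_left mult.commute[of b x] by linarith
qed

section \<open>The Apery set: least elements of \<open>S\<close> in the residue classes modulo
  \<open>g\<close>\<close>

definition apery :: "nat set \<Rightarrow> nat \<Rightarrow> nat \<Rightarrow> nat" where
  "apery S g n = (LEAST a. a \<in> S \<and> a mod g = n mod g)"

text \<open>Each residue class is infinite, so it cannot lie in the finite complement of
  \<open>S\<close>, and the \<open>LEAST\<close> is taken over a nonempty set.\<close>

lemma apery:
  assumes "finite (UNIV - S)" "g > 0"
  shows "apery S g n \<in> S" "apery S g n mod g = n mod g"
proof -
  have "inj (\<lambda>k. n + g * k)" using assms(2) by (auto simp: inj_def)
  then have "infinite (range (\<lambda>k. n + g * k))" by (rule range_inj_infinite)
  then have "\<not> range (\<lambda>k. n + g * k) \<subseteq> UNIV - S"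
    using assms(1) finite_subset by blast
  then obtain k where "n + g * k \<in> S" by auto
  then have "n + g * k \<in> S \<and> (n + g * k) mod g = n mod g" by simp
  from LeastI[of "\<lambda>a. a \<in> S \<and> a mod g = n mod g", OF this]
  show "apery S g n \<in> S" "apery S g n mod g = n mod g" by (auto simp: apery_def)
qed

lemma apery_le: "a \<in> S \<Longrightarrow> a mod g = n mod g \<Longrightarrow> apery S g n \<le> a"
  unfolding apery_def by (rule Least_le) simp

lemma apery_cong: "m mod g = n mod g \<Longrightarrow> apery S g m = apery S g n"
  by (simp add: apery_def)

text \<open>The last summand depends only on the residue of \<open>n\<close> modulo
  \<open>g\<close>; this is what makes the maximum quasipolynomial.\<close>

lemma ell_max_eq_apery:
  assumes g: "g > 0" and hs: "\<forall>h\<in>set hs. g < h" and p: "p \<ge> 2"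
    and fin: "finite (UNIV - generated (g # hs))"
    and n: "n = g * N + apery (generated (g # hs)) g n"
    and N: "N > apery (generated (g # hs)) g n ^ p"
  shows "ell_max (g # hs) p n
           = N ^ p + ell_max (g # hs) p (apery (generated (g # hs)) g n)"
proof -
  define a where "a = apery (generated (g # hs)) g n"
  have n: "n = g * N + a" and N: "N > a ^ p" using n N by (simp_all only: a_def)
  have 0: "0 \<notin> set (g # hs)" using g hs by auto
  have a: "a \<in> generated (g # hs)" "a mod g = n mod g"
    unfolding a_def using apery[OF fin g] by auto
  obtain z where "z \<in> factorizations (g # hs) a" and max: "ell_max (g # hs) p a = ell p z"
    using ell_max_attained[OF 0 a(1)] by blast
  then obtain x ys w where z: "z = x # ys" "ys \<in> factorizations hs w" "a = x * g + w"
    by (auto simp: factorizations_Cons)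
  \<comment> \<open>Lower bound: add \<open>N\<close> copies of \<open>g\<close> to an optimal
    factorization of \<open>a\<close>.\<close>
  have z': "(N + x) # ys \<in> factorizations (g # hs) n"
    using z n by (auto simp: factorizations_Cons algebra_simps)
  have "N ^ p + ell_max (g # hs) p a \<le> ell p ((N + x) # ys)"
    using power_add_le_add_power[of N x p] p by (simp add: max z(1))
  also have "\<dots> \<le> ell_max (g # hs) p n"
    by (rule ell_le_ell_max[OF 0 z'])
  finally have lower: "N ^ p + ell_max (g # hs) p a \<le> ell_max (g # hs) p n" .
  have "n \<in> generated (g # hs)" using z' by (auto simp: generated_iff)
  then obtain z where "z \<in> factorizations (g # hs) n" and max: "ell_max (g # hs) p n = ell p z"
    using ell_max_attained[OF 0] by blast
  then obtain x ys w where z: "z = x # ys" "ys \<in> factorizations hs w" "n = x * g + w"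
    by (auto simp: factorizations_Cons)
  \<comment> \<open>Without its copies of \<open>g\<close>, the factorization shows that
    \<open>w\<close> lies in the semigroup. As \<open>w\<close> is congruent to \<open>n\<close>
    modulo \<open>g\<close>, minimality gives \<open>a \<le> w\<close>.\<close>
  have w: "0 # ys \<in> factorizations (g # hs) w" using z by (auto simp: factorizations_Cons)
  have "a \<le> w"
    unfolding a_def by (rule apery_le) (use w z in \<open>auto simp: generated_iff\<close>)
  have "ell p z \<le> N ^ p + ell_max (g # hs) p a"
  proof (cases "w = a")
    case True
    then have "x = N" using z n g by simp
    moreover have "ell p ys \<le> ell_max (g # hs) p a"
      using ell_le_ell_max[OF 0 w, of p] p True by (simp add: zero_power)
    ultimately show ?thesis using z by simp
  next
    case False
    with \<open>a \<le> w\<close> z(3) n have "g * x < g * N" by (simp only: mult.commute[of x g])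
    then have x: "x < N" by simp
    define y where "y = ell 1 ys"
    have y: "Suc g * y \<le> w"
      unfolding y_def using hs z by (intro ell_1_le_factorizations) (auto simp: Suc_le_eq)
    have "ell p z \<le> x ^ p + y ^ p"
      using ell_le_power_ell_1[of p ys] p z by (simp add: y_def)
    also have "\<dots> \<le> N ^ p"
    proof (cases "a \<le> y")
      case True
      \<comment> \<open>Each atom other than \<open>g\<close> costs at least one more than
        \<open>g\<close>; this extra cost \<open>y\<close> absorbs \<open>a\<close>.\<close>
      have "g * x + g * y + y \<le> g * N + a" using y z n by (simp add: algebra_simps)
      with True have "g * (x + y) \<le> g * N" by (simp add: algebra_simps)
      then have "x + y \<le> N" using g by simp
      have "x ^ p + y ^ p \<le> (x + y) ^ p" using p by (intro power_add_le_add_power) auto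
      also have "\<dots> \<le> N ^ p" using \<open>x + y \<le> N\<close> by (simp add: power_mono)
      finally show ?thesis .
    next
      case False
      \<comment> \<open>The threshold on \<open>N\<close> and \<open>p \<ge> 2\<close> bound
        \<open>y ^ p\<close> by \<open>N ^ (p - 1)\<close>, which is exactly the gap between
        \<open>(N - 1) * N ^ (p - 1)\<close> and \<open>N ^ p\<close>.\<close>
      then have "y ^ p \<le> a ^ p" by (simp add: power_mono)
      also have "\<dots> \<le> N" using N by simp
      also have "N \<le> N ^ (p - 1)" using p N by (intro self_le_power) auto
      finally have y: "y ^ p \<le> N ^ (p - 1)" .
      have p': "p = Suc (p - 1)" using p by simp
      have "x ^ p = x * x ^ (p - 1)" by (subst p') simp
      also have "\<dots> \<le> (N - 1) * N ^ (p - 1)"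
        using x by (intro mult_mono power_mono) auto
      finally have "x ^ p + y ^ p \<le> (N - 1) * N ^ (p - 1) + N ^ (p - 1)"
        using y by simp
      also have "\<dots> = Suc (N - 1) * N ^ (p - 1)" by simp
      also have "\<dots> = N ^ p" using x by (subst (2) p') simp
      finally show ?thesis .
    qed
    finally show ?thesis by simp
  qed
  with lower max show ?thesis by (simp add: a_def)
qed

theorem theorem2p8:
  fixes S :: "nat set" and gs :: "nat list" and p :: nat
  assumes "numerical_semigroup S"
    and "minimally_generated_by S gs"
    and "p \<ge> 2"
  shows "eventually_quasipolynomial (\<lambda>n. real (ell_max gs p n)) p (gs ! 0)
           (\<lambda>n. 1 / real (gs ! 0) ^ p)"
proof -
  have fin: "finite (UNIV - S)" using assms(1) by (simp add: numerical_semigroup_def)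
  have S: "S = generated gs" and sorted: "sorted_wrt (<) gs" and atoms: "set gs = atoms S"
    using assms(2) by (auto simp: minimally_generated_by_def)
  have "gs \<noteq> []"
  proof
    assume "gs = []"
    then have "S \<subseteq> {0}" using S by (auto simp: generated_def)
    then have "finite (UNIV :: nat set)"
      using fin by (metis finite.simps finite_Diff2 finite_subset)
    then show False by simp
  qed
  then obtain g hs where gs: "gs = g # hs" by (cases gs) auto
  have "g \<in> atoms S" using atoms gs by auto
  then have g: "g > 0" by (simp add: atoms_def)
  have hs: "\<forall>h\<in>set hs. g < h" using sorted gs by simp
  define a where "a n = apery S g n" for n
  have a_mod: "a n mod g = n mod g" for n
    using apery[OF fin g] by (simp add: a_def)
  have a_per: "a (n + g) = a n" for n
    unfolding a_def by (rule apery_cong) simp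
  \<comment> \<open>A bound uniform over all residue classes, so that one threshold serves every
    \<open>n\<close>.\<close>
  define A where "A = Max (a ` {..<g})"
  have a_le: "a n \<le> A" for n
  proof -
    have "a n = a (n mod g)" unfolding a_def by (rule apery_cong) simp
    also have "\<dots> \<le> A" unfolding A_def using g by (intro Max_ge) auto
    finally show ?thesis .
  qed
  \<comment> \<open>Binomial coefficients of \<open>((n - a n) / g) ^ p\<close>; the constant term
    also receives the maximum for \<open>a n\<close>.\<close>
  define c where "c i n = real (p choose i) * (- real (a n)) ^ (p - i) / real g ^ p
      + (if i = 0 then real (ell_max gs p (a n)) else 0)" for i n
  define h where "h n = (\<Sum>i\<le>p. c i n * real n ^ i)" for n
  have h: "h n = ((real n - real (a n)) / real g) ^ p + real (ell_max gs p (a n))" for n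
  proof -
    have "h n = (\<Sum>i\<le>p. of_nat (p choose i) * real n ^ i * (- real (a n)) ^ (p - i)) / real g ^ p
        + (\<Sum>i\<le>p. if i = 0 then real (ell_max gs p (a n)) else 0)"
      unfolding h_def c_def sum_divide_distrib sum.distrib[symmetric]
      by (intro sum.cong) (auto simp: field_simps)
    then show ?thesis
      by (simp add: binomial_ring[symmetric] power_divide)
  qed
  \<comment> \<open>The summand \<open>A\<close> keeps the natural subtraction
    \<open>n - a n\<close> exact; the other one forces \<open>N > A ^ p\<close>.\<close>
  have "real (ell_max gs p n) = h n" if n: "n \<ge> A + g * Suc (A ^ p)" for n
  proof -
    define N where "N = (n - a n) div g"
    have le: "a n \<le> n" using a_le[of n] n by simp
    have "g dvd n - a n" using a_mod[of n] le by (metis mod_eq_dvd_iff_nat)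
    then have "g * N = n - a n" by (simp add: N_def)
    then have nN: "n = g * N + a n" using le by simp
    have "g * Suc (A ^ p) \<le> g * N" using nN n a_le[of n] by linarith
    then have "Suc (A ^ p) \<le> N" using g by (simp only: nat_mult_le_cancel1)
    moreover have "a n ^ p \<le> A ^ p" using a_le by (simp add: power_mono)
    ultimately have "N > a n ^ p" by simp
    with nN have "ell_max gs p n = N ^ p + ell_max gs p (a n)"
      using ell_max_eq_apery[OF g hs assms(3)] fin unfolding a_def S gs by blast
    moreover have "real n - real (a n) = real g * real N"
      by (subst (1) nN) simp
    ultimately show ?thesis using g by (simp add: h)
  qed
  then have "{n. real (ell_max gs p n) \<noteq> h n} \<subseteq> {..<A + g * Suc (A ^ p)}"
    by (auto simp: not_le[symmetric] simp del: mult_Suc_right)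
  then have ev: "finite {n. real (ell_max gs p n) \<noteq> h n}"
    by (rule finite_subset) simp
  have per: "is_period (c i) g" for i
    using g by (simp add: is_period_def c_def a_per)
  have lead: "c p = (\<lambda>n. 1 / real g ^ p)" using assms(3) by (auto simp: c_def)
  have coeffs: "quasipolynomial_coeffs h p c"
    unfolding quasipolynomial_coeffs_def using per lead g by (auto simp: periodic_def h_def)
  have "g dvd min_period (c (p - 1))"
  proof -
    define t where "t = min_period (c (p - 1))"
    have "is_period (c (p - 1)) t"
      unfolding t_def using per by (intro is_period_min_period) (auto simp: periodic_def)
    then have "c (p - 1) (0 + t) = c (p - 1) 0" by (simp only: is_period_def)
    moreover have "p choose (p - 1) \<noteq> 0" by (simp add: binomial_eq_0_iff)
    \<comment> \<open>Since \<open>p \<ge> 2\<close>, the index \<open>p - 1\<close> is positive, so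
      the extra constant term is absent and \<open>c (p - 1) n\<close> is
      \<open>- p * a n / g ^ p\<close>, which is injective in \<open>a n\<close>.\<close>
    ultimately have "a t = a 0" using assms(3) g by (simp add: c_def)
    then show "g dvd min_period (c (p - 1))"
      using a_mod[of t] a_mod[of 0] by (simp add: t_def mod_eq_0_iff_dvd)
  qed
  then have "g dvd Lcm ((\<lambda>i. min_period (c i)) ` {..p})"
    by (rule dvd_trans) (auto intro: dvd_Lcm)
  moreover have "Lcm ((\<lambda>i. min_period (c i)) ` {..p}) dvd g"
    using min_period_dvd[OF per] by (auto intro: Lcm_least)
  ultimately have "g = Lcm ((\<lambda>i. min_period (c i)) ` {..p})"
    by (rule dvd_antisym)
  with coeffs lead have "quasipolynomial h p g (\<lambda>n. 1 / real g ^ p)"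
    unfolding quasipolynomial_def by metis
  with ev show ?thesis
    unfolding eventually_quasipolynomial_def by (auto simp: gs)
qed

end
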